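(* Let $f\colon A\to B$ be a morphism of $A_\infty$-algebras over a field $\mathbb{K}$ and $m\ge2$. If the Massey product of $\alpha_1,\dots,\alpha_m\in\mathrm{H}(A)$ is defined, then so is that of $(f_1)_*(\alpha_1),\dots,(f_1)_*(\alpha_m)\in\mathrm{H}(B)$, and $$\langle(f_1)_*(\alpha_1),\dots,(f_1)_*(\alpha_m)\rangle\supset(f_1)_*\langle\alpha_1,\dots,\alpha_m\rangle.$$
   Context: $A_\infty$-algebra: a $\mathbb{Z}$- or $\mathbb{Z}_2$-graded $\mathbb{K}$-vector space $A$ with graded multilinear maps $b_n\colon A^{\otimes n}\to A$ ($n\ge1$) of degree $1$ such that for each $n\ge1$, $\sum_{r,t\ge0,\,s\ge1,\,r+s+t=n}b_{r+1+t}\circ(1^{\otimes r}\otimes b_s\otimes1^{\otimes t})=0$ (Koszul sign rule $(f\otimes g)(x\otimes y)=(-1)^{|g||x|}f(x)\otimes g(y)$). $\mathrm{H}(A)$ is the cohomology of $(A,b_1)$. A morphism $f\colon A\to B$ is a family of multilinear maps $f_n\colon A^{\otimes n}\to B$ ($n\ge1$) of degree $0$ with, for each $n\ge1$, $$\sum_{r,t\ge0,\,s\ge1,\,r+s+t=n}f_{r+1+t}\circ(1^{\otimes r}\otimes b^A_s\otimes1^{\otimes t})=\sum_{r\ge1;\,i_1,\dots,i_r>0;\,i_1+\cdots+i_r=n}b^B_r\circ(f_{i_1}\otimes\cdots\otimes f_{i_r}).$$ In particular $f_1\colon(A,b_1^A)\to(B,b_1^B)$ is a cochain map. $\mathrm{Mat}^{(m+1)}_+(A)$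 is the space of strictly upper-triangular matrices $\mathbf{a}=(a_{ij})_{0\le i,j\le m}$ with entries in $A$. The product $\odot$ of matrices is $(\mathbf{a}\odot\mathbf{b})_{ij}=\sum_ka_{ik}\otimes b_{kj}$ (no signs); $b_n$ acts component-wise on matrices with entries in $A^{\otimes n}$. For $\mathbf{a}\in\mathrm{Mat}^{(m+1)}_+(A)$, $\partial_{\mathbf{a}}\mathbf{a}=\sum_{n\ge1}b_n(\underbrace{\mathbf{a}\odot\cdots\odot\mathbf{a}}_n)$ (a finite sum), and $\mathbf{a}\approx\mathbf{a}'$ means $a_{ij}=a'_{ij}$ for all $(i,j)\ne(0,m)$. For $m\ge2$, $\mathbf{a}\in\mathrm{Mat}^{(m+1)}_+(A)$ is a defining system for $\alpha_1,\dots,\alpha_m\in\mathrm{H}(A)$ if $\partial_{\mathbf{a}}\mathbf{a}\approx0$ and each $\alpha_i$ is represented by the (then closed) element $a_{i-1,i}$. Put $\mu(\mathbf{a})=(\partial_{\mathbf{a}}\mathbf{a})_{0m}\in A$, which is $b_1$-closed. The Massey product of $\alpha_1,\dots,\alpha_m$ is defined if a defining system exists; $\langle\alpha_1,\dots,\alpha_m\rangle\subset\mathrm{H}(A)$ is the set of classes $[\mu(\mathbf{a})]$ over all defining systems $\mathbf{a}$ of $\alpha_1,\dots,\alpha_m$. *)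

theory Defs
  imports Complex_Main "HOL-Library.Z2"
begin

section \<open>Graded vector spaces\<close>

text \<open>
  Gradings are by \<open>\<int>\<close> or by \<open>\<int>/2\<close>. The index types admitted by the following class are exactly
  the copies of these two rings: the image of \<open>\<int>\<close> is everything, and its kernel is
  \<open>0\<close> or (as \<open>0 \<noteq> 1\<close>) \<open>2\<int>\<close>.
\<close>

class grading_index = comm_ring_1 +
  assumes of_int_surj: "\<exists>k. d = of_int k"
    and of_int_inj_or_two_eq_0: "(\<forall>k l. of_int k = of_int l \<longrightarrow> k = l) \<or> 1 + 1 = 0"

instance int :: grading_index
  by standard auto

instance bit :: grading_index
proof
  fix d :: bit
  show "\<exists>k. d = of_int k"
    by (cases d) (auto intro: exI[of _ 0] exI[of _ 1])
qed simp

locale graded_vector_space = vector_space scale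
  for scale :: "'k::field \<Rightarrow> 'a::ab_group_add \<Rightarrow> 'a" +
  fixes V :: "'g::grading_index \<Rightarrow> 'a set"
  assumes subspace_V: "subspace (V d)"
    and direct_sum: "\<exists>!c. finite {d. c d \<noteq> 0} \<and> (\<forall>d. c d \<in> V d) \<and> x = (\<Sum>d | c d \<noteq> 0. c d)"

text \<open>The element \<open>(-1)\<^sup>d x\<close>. In \<open>\<int>/2\<close> one has \<open>2 = 0\<close>, so there \<open>2 dvd d\<close> means \<open>d = 0\<close>.\<close>

definition koszul :: "'g::grading_index \<Rightarrow> 'a::ab_group_add \<Rightarrow> 'a" where
  "koszul d x = (if 2 dvd d then x else - x)"

text \<open>
  A linear map \<open>A\<^sup>\<otimes>\<^sup>n \<rightarrow> B\<close> is represented by a function on lists of length \<open>n\<close>, multilinear in the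
  entries. A family \<open>(f\<^sub>n)\<close>, \<open>n \<ge> 1\<close>, of such maps is a single function on lists, \<open>f\<^sub>n\<close> being its
  restriction to lists of length \<open>n\<close>; the value on the empty list is never used.
\<close>

definition multilinear ::
    "('k::field \<Rightarrow> 'a::ab_group_add \<Rightarrow> 'a) \<Rightarrow> ('k \<Rightarrow> 'b::ab_group_add \<Rightarrow> 'b) \<Rightarrow> nat \<Rightarrow> ('a list \<Rightarrow> 'b) \<Rightarrow> bool" where
  "multilinear scaleA scaleB n f \<longleftrightarrow>
    (\<forall>xs i. length xs = n \<and> i < n \<longrightarrow> Vector_Spaces.linear scaleA scaleB (\<lambda>x. f (xs[i := x])))"

definition homogeneous :: "('g \<Rightarrow> 'a set) \<Rightarrow> 'a list \<Rightarrow> 'g list \<Rightarrow> bool" where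
  "homogeneous V xs ds \<longleftrightarrow> list_all2 (\<lambda>x d. x \<in> V d) xs ds"

definition has_degree ::
    "('g::grading_index \<Rightarrow> 'a set) \<Rightarrow> ('g \<Rightarrow> 'b set) \<Rightarrow> 'g \<Rightarrow> nat \<Rightarrow> ('a list \<Rightarrow> 'b) \<Rightarrow> bool" where
  "has_degree V W k n f \<longleftrightarrow>
    (\<forall>xs ds. length xs = n \<and> homogeneous V xs ds \<longrightarrow> f xs \<in> W (sum_list ds + k))"

section \<open>\<open>A\<^sub>\<infinity>\<close>-algebras and their morphisms\<close>

text \<open>
  The value of \<open>\<Sum> g\<^bsub>r+1+t\<^esub> \<circ> (1\<^sup>\<otimes>\<^sup>r \<otimes> b\<^sub>s \<otimes> 1\<^sup>\<otimes>\<^sup>t)\<close> on \<open>x\<^sub>1 \<otimes> \<dots> \<otimes> x\<^sub>n\<close>, where \<open>x\<^sub>i\<close> is homogeneous of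
  degree \<open>d\<^sub>i\<close>. As \<open>b\<^sub>s\<close> has degree 1, moving it past \<open>x\<^sub>1, \<dots>, x\<^sub>r\<close> gives the sign
  with exponent \<open>d\<^sub>1 + \<dots> + d\<^sub>r\<close>.
\<close>

definition insertion_sum ::
    "('a list \<Rightarrow> 'b::ab_group_add) \<Rightarrow> ('a list \<Rightarrow> 'a) \<Rightarrow> 'a list \<Rightarrow> 'g::grading_index list \<Rightarrow> 'b" where
  "insertion_sum g b xs ds =
    (\<Sum>(r, s, t) \<in> {(r, s, t). 1 \<le> s \<and> r + s + t = length xs}.
      koszul (sum_list (take r ds)) (g (take r xs @ [b (take s (drop r xs))] @ drop (r + s) xs)))"

locale A_infinity_algebra = graded_vector_space scale V
  for scale :: "'k::field \<Rightarrow> 'a::ab_group_add \<Rightarrow> 'a"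
    and V :: "'g::grading_index \<Rightarrow> 'a set" +
  fixes b :: "'a list \<Rightarrow> 'a"
  assumes multilinear_b: "1 \<le> n \<Longrightarrow> multilinear scale scale n b"
    and degree_b: "1 \<le> n \<Longrightarrow> has_degree V V 1 n b"
    and A_infinity_relation: "1 \<le> length xs \<Longrightarrow> homogeneous V xs ds \<Longrightarrow> insertion_sum b b xs ds = 0"

definition compositions :: "nat \<Rightarrow> nat list set" where
  "compositions n = {is. 1 \<le> length is \<and> (\<forall>i \<in> set is. 0 < i) \<and> sum_list is = n}"

fun blocks :: "nat list \<Rightarrow> 'a list \<Rightarrow> 'a list list" where
  "blocks [] xs = []"
| "blocks (i # is) xs = take i xs # blocks is (drop i xs)"

text \<open>No signs occur on the right-hand side of the morphism relation, since the \<open>f\<^sub>i\<close> have degree 0.\<close>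

locale A_infinity_morphism =
  A: A_infinity_algebra scaleA VA bA + B: A_infinity_algebra scaleB VB bB
  for scaleA :: "'k::field \<Rightarrow> 'a::ab_group_add \<Rightarrow> 'a"
    and VA :: "'g::grading_index \<Rightarrow> 'a set"
    and bA :: "'a list \<Rightarrow> 'a"
    and scaleB :: "'k \<Rightarrow> 'b::ab_group_add \<Rightarrow> 'b"
    and VB :: "'g \<Rightarrow> 'b set"
    and bB :: "'b list \<Rightarrow> 'b" +
  fixes f :: "'a list \<Rightarrow> 'b"
  assumes multilinear_f: "1 \<le> n \<Longrightarrow> multilinear scaleA scaleB n f"
    and degree_f: "1 \<le> n \<Longrightarrow> has_degree VA VB 0 n f"
    and morphism_relation: "1 \<le> length xs \<Longrightarrow> homogeneous VA xs ds \<Longrightarrow>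
      insertion_sum f bA xs ds = (\<Sum>is \<in> compositions (length xs). bB (map f (blocks is xs)))"

text \<open>The index sets of the above sums are finite, so the sums have their intended meaning.\<close>

lemma finite_insertion_index: "finite {(r, s, t). 1 \<le> s \<and> r + s + t = (n::nat)}"
  by (rule finite_subset[of _ "{..n} \<times> {..n} \<times> {..n}"]) auto

lemma finite_compositions: "finite (compositions n)"
proof (rule finite_subset)
  show "compositions n \<subseteq> {is. set is \<subseteq> {..n} \<and> length is \<le> n}"
  proof
    fix "is" assume "is \<in> compositions n"
    then have pos: "\<forall>i \<in> set is. 0 < i" and sum: "sum_list is = n"
      by (auto simp: compositions_def)
    have "length is \<le> sum_list is"
      using pos by (induction "is") auto
    moreover have "set is \<subseteq> {..n}"
      using member_le_sum_list sum by auto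
    ultimately show "is \<in> {is. set is \<subseteq> {..n} \<and> length is \<le> n}"
      using sum by simp
  qed
qed (simp add: finite_lists_length_le)

section \<open>Cohomology\<close>

text \<open>
  For an additive \<open>d\<close> with \<open>d \<circ> d = 0\<close> (here \<open>b\<^sub>1\<close>) the cohomology is the quotient of the cocycles by
  the relation of differing by a coboundary; cohomology classes are cosets.
\<close>

definition cohomologous :: "('a::ab_group_add \<Rightarrow> 'a) \<Rightarrow> ('a \<times> 'a) set" where
  "cohomologous d = {(x, y). d x = 0 \<and> d y = 0 \<and> x - y \<in> range d}"

definition cohomology :: "('a::ab_group_add \<Rightarrow> 'a) \<Rightarrow> 'a set set" where
  "cohomology d = {x. d x = 0} // cohomologous d"

definition coh_class :: "('a::ab_group_add \<Rightarrow> 'a) \<Rightarrow> 'a \<Rightarrow> 'a set" where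
  "coh_class d x = cohomologous d `` {x}"

text \<open>The map on cohomology induced by a cochain map \<open>g\<close> into a complex with differential \<open>d\<close>.\<close>

definition coh_map :: "('b::ab_group_add \<Rightarrow> 'b) \<Rightarrow> ('a \<Rightarrow> 'b) \<Rightarrow> 'a set \<Rightarrow> 'b set" where
  "coh_map d g \<alpha> = (\<Union>x \<in> \<alpha>. coh_class d (g x))"

lemma equiv_cohomologous:
  assumes "additive d"
  shows "equiv {x. d x = 0} (cohomologous d)"
proof (rule equivI)
  interpret additive d by fact
  show "cohomologous d \<subseteq> {x. d x = 0} \<times> {x. d x = 0}"
    by (auto simp: cohomologous_def)
  show "refl_on {x. d x = 0} (cohomologous d)"
    using zero by (auto simp: refl_on_def cohomologous_def intro: range_eqI[of _ _ 0])
  show "sym (cohomologous d)"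
  proof (rule symI)
    fix x y assume "(x, y) \<in> cohomologous d"
    then obtain z where "d x = 0" "d y = 0" "x - y = d z"
      by (auto simp: cohomologous_def)
    moreover from this have "y - x = d (- z)"
      using minus[of z] minus_diff_eq[of x y] by simp
    ultimately show "(y, x) \<in> cohomologous d"
      by (auto simp: cohomologous_def)
  qed
  show "trans (cohomologous d)"
  proof (rule transI)
    fix x y z assume "(x, y) \<in> cohomologous d" "(y, z) \<in> cohomologous d"
    then obtain u v where "d x = 0" "d z = 0" "x - y = d u" "y - z = d v"
      by (auto simp: cohomologous_def)
    moreover from this have "x - z = d (u + v)"
      by (simp add: add algebra_simps)
    ultimately show "(x, z) \<in> cohomologous d"
      by (auto simp: cohomologous_def)
  qed
qed

lemma coh_map_coh_class:
  assumes "additive d" "additive d'" "additive g" "\<And>y. g (d y) = d' (g y)" "d x = 0"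
  shows "coh_map d' g (coh_class d x) = coh_class d' (g x)"
proof -
  interpret g: additive g by fact
  have "(\<lambda>x. cohomologous d' `` {g x}) respects cohomologous d"
  proof (rule congruentI)
    fix y z assume "(y, z) \<in> cohomologous d"
    then obtain w where w: "d y = 0" "d z = 0" "y - z = d w"
      by (auto simp: cohomologous_def)
    have "g y - g z = d' (g w)"
      using assms(4)[of w] g.diff[of y z] w(3) by simp
    moreover have "d' (g y) = 0" "d' (g z) = 0"
      using assms(4)[of y] assms(4)[of z] w(1,2) g.zero by simp_all
    ultimately have "(g y, g z) \<in> cohomologous d'"
      by (auto simp: cohomologous_def)
    then show "cohomologous d' `` {g y} = cohomologous d' `` {g z}"
      by (rule equiv_class_eq[OF equiv_cohomologous[OF assms(2)]])
  qed
  then show ?thesis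
    unfolding coh_map_def coh_class_def
    using UN_equiv_class[OF equiv_cohomologous[OF assms(1)]] assms(5) by simp
qed

section \<open>Massey products\<close>

text \<open>
  Matrices have indices \<open>0, \<dots>, m\<close>; the entries with an index outside this range are fixed to be 0.
\<close>

definition Mat_plus :: "nat \<Rightarrow> (nat \<Rightarrow> nat \<Rightarrow> 'a::zero) set" where
  "Mat_plus m = {a. \<forall>i j. \<not> (i < j \<and> j \<le> m) \<longrightarrow> a i j = 0}"

text \<open>
  By expanding the products, the \<open>(i,j)\<close> entry of the \<open>n\<close>-fold product \<open>a \<odot> \<dots> \<odot> a\<close> is the
  sum of the elementary tensors \<open>a\<^bsub>k\<^sub>0k\<^sub>1\<^esub> \<otimes> a\<^bsub>k\<^sub>1k\<^sub>2\<^esub> \<otimes> \<dots> \<otimes> a\<^bsub>k\<^sub>n\<^sub>-\<^sub>1k\<^sub>n\<^esub>\<close> over all sequences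
  \<open>k\<^sub>0, \<dots>, k\<^sub>n\<close> in \<open>{0..m}\<close> with \<open>k\<^sub>0 = i\<close> and \<open>k\<^sub>n = j\<close>; the linear map \<open>b\<^sub>n\<close> is applied to this sum.
\<close>

definition index_paths :: "nat \<Rightarrow> nat \<Rightarrow> nat \<Rightarrow> nat \<Rightarrow> nat list set" where
  "index_paths m n i j =
    {ks. length ks = n + 1 \<and> set ks \<subseteq> {0..m} \<and> ks ! 0 = i \<and> ks ! n = j}"

definition path_tensor :: "(nat \<Rightarrow> nat \<Rightarrow> 'a) \<Rightarrow> nat list \<Rightarrow> 'a list" where
  "path_tensor a ks = map (\<lambda>(k, l). a k l) (zip ks (tl ks))"

definition apply_odot_power ::
    "('a list \<Rightarrow> 'a::ab_group_add) \<Rightarrow> nat \<Rightarrow> (nat \<Rightarrow> nat \<Rightarrow> 'a) \<Rightarrow> nat \<Rightarrow> nat \<Rightarrow> nat \<Rightarrow> 'a" where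
  "apply_odot_power b m a n i j = (\<Sum>ks \<in> index_paths m n i j. b (path_tensor a ks))"

text \<open>The terms with \<open>n > m\<close> vanish, see \<open>apply_odot_power_eq_0\<close> below.\<close>

definition boundary ::
    "('a list \<Rightarrow> 'a::ab_group_add) \<Rightarrow> nat \<Rightarrow> (nat \<Rightarrow> nat \<Rightarrow> 'a) \<Rightarrow> nat \<Rightarrow> nat \<Rightarrow> 'a" where
  "boundary b m a i j = (\<Sum>n = 1..m. apply_odot_power b m a n i j)"

lemma finite_index_paths: "finite (index_paths m n i j)"
  by (rule finite_subset[OF _ finite_lists_length_eq[of "{0..m}" "n + 1"]])
    (auto simp: index_paths_def)

lemma (in A_infinity_algebra) apply_odot_power_eq_0:
  assumes a: "a \<in> Mat_plus m" and n: "m < n"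
  shows "apply_odot_power b m a n i j = 0"
  unfolding apply_odot_power_def
proof (rule sum.neutral, rule ballI)
  fix ks assume "ks \<in> index_paths m n i j"
  then have len: "length ks = n + 1" and sub: "set ks \<subseteq> {0..m}"
    by (auto simp: index_paths_def)
  have "\<exists>p<n. \<not> ks ! p < ks ! (p + 1)"
  proof (rule ccontr)
    assume "\<not> ?thesis"
    then have inc: "ks ! p < ks ! (p + 1)" if "p < n" for p
      using that by blast
    have "p \<le> n \<Longrightarrow> p \<le> ks ! p" for p
    proof (induction p)
      case (Suc p)
      then show ?case using inc[of p] by simp
    qed simp
    from this[of n] have "m < ks ! n" using n by simp
    moreover have "ks ! n \<in> set ks" using len by simp
    ultimately show False using sub by auto
  qed
  then obtain p where p: "p < n" "\<not> ks ! p < ks ! (p + 1)" by blast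
  have len': "length (path_tensor a ks) = n"
    using len by (simp add: path_tensor_def)
  have "path_tensor a ks ! p = 0"
    using a p len by (simp add: path_tensor_def Mat_plus_def nth_tl)
  then have eq: "(path_tensor a ks)[p := 0] = path_tensor a ks"
    using list_update_id[of "path_tensor a ks" p] by simp
  have "Vector_Spaces.linear scale scale (\<lambda>x. b ((path_tensor a ks)[p := x]))"
    using multilinear_b[of n] p(1) len' by (auto simp: multilinear_def)
  then have "b ((path_tensor a ks)[p := 0]) = 0"
    by (rule module_hom.zero[OF Vector_Spaces.linear.axioms(3)])
  then show "b (path_tensor a ks) = 0"
    using eq by simp
qed

definition approx_eq :: "nat \<Rightarrow> (nat \<Rightarrow> nat \<Rightarrow> 'a) \<Rightarrow> (nat \<Rightarrow> nat \<Rightarrow> 'a) \<Rightarrow> bool" where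
  "approx_eq m a a' \<longleftrightarrow> (\<forall>i\<le>m. \<forall>j\<le>m. (i, j) \<noteq> (0, m) \<longrightarrow> a i j = a' i j)"

text \<open>The classes \<open>\<alpha>\<^sub>1, \<dots>, \<alpha>\<^sub>m\<close> are given by a function on \<open>nat\<close>, of which only the values on
  \<open>{1..m}\<close> matter.\<close>

definition defining_system ::
    "('a list \<Rightarrow> 'a::ab_group_add) \<Rightarrow> nat \<Rightarrow> (nat \<Rightarrow> 'a set) \<Rightarrow> (nat \<Rightarrow> nat \<Rightarrow> 'a) \<Rightarrow> bool" where
  "defining_system b m \<alpha> a \<longleftrightarrow>
    a \<in> Mat_plus m \<and> approx_eq m (boundary b m a) (\<lambda>i j. 0) \<and>
    (\<forall>i \<in> {1..m}. \<alpha> i = coh_class (\<lambda>x. b [x]) (a (i - 1) i))"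

definition massey_value ::
    "('a list \<Rightarrow> 'a::ab_group_add) \<Rightarrow> nat \<Rightarrow> (nat \<Rightarrow> nat \<Rightarrow> 'a) \<Rightarrow> 'a" where
  "massey_value b m a = boundary b m a 0 m"

definition massey_defined ::
    "('a list \<Rightarrow> 'a::ab_group_add) \<Rightarrow> nat \<Rightarrow> (nat \<Rightarrow> 'a set) \<Rightarrow> bool" where
  "massey_defined b m \<alpha> \<longleftrightarrow> (\<exists>a. defining_system b m \<alpha> a)"

definition massey_product ::
    "('a list \<Rightarrow> 'a::ab_group_add) \<Rightarrow> nat \<Rightarrow> (nat \<Rightarrow> 'a set) \<Rightarrow> 'a set set" where
  "massey_product b m \<alpha> =
    {coh_class (\<lambda>x. b [x]) (massey_value b m a) | a. defining_system b m \<alpha> a}"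

end

theory Submission
  imports Defs
begin

text \<open>
  A morphism pushes a defining system \<open>a\<close> of \<open>A\<close> forward to the matrix
  \<open>c = \<Sum>\<^sub>n f\<^sub>n(a \<odot> \<dots> \<odot> a)\<close>, whose entry \<open>c\<^sub>i\<^sub>j\<close> is the sum of \<open>f(a\<^bsub>k\<^sub>0k\<^sub>1\<^esub>, \<dots>, a\<^bsub>k\<^sub>n\<^sub>-\<^sub>1k\<^sub>n\<^esub>)\<close> over all
  increasing paths \<open>i = k\<^sub>0 < \<dots> < k\<^sub>n = j\<close>. The reason is the identity
  \<open>\<partial>\<^sub>c c = f\<^sub>1(\<partial>\<^sub>a a)\<close>. It makes \<open>c\<close> a defining system with \<open>\<mu>(c) = f\<^sub>1(\<mu>(a))\<close>, and on the first
  superdiagonal \<open>c\<close> is \<open>f\<^sub>1(a)\<close>, so it represents the images of the given classes.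

  The identity is the morphism relation summed over all paths from \<open>i\<close> to \<open>j\<close>. A path together with
  a division into consecutive blocks is the same as a coarser path together with a refinement of each
  of its steps. On the right-hand side, summing \<open>f\<close> over the refinements of a step gives an entry
  of \<open>c\<close>, so the total is \<open>(\<partial>\<^sub>c c)\<^sub>i\<^sub>j\<close> (lemma \<open>path_sum_composition_sum\<close>). On the left-hand
  side, the inserted \<open>b\<close> is summed over the paths between the two cut points \<open>k < l\<close> and gives the entry
  \<open>(\<partial>\<^sub>a a)\<^sub>k\<^sub>l\<close>. This vanishes unless \<open>(k, l) = (0, m)\<close>, so only the term survives in which nothing
  stands on either side of \<open>b\<close>; that term is \<open>f\<^sub>1((\<partial>\<^sub>a a)\<^sub>i\<^sub>j)\<close> and carries no sign
  (lemma \<open>path_sum_signed_insertion\<close>). Both lemmas rest on \<open>path_sum_cut\<close>, which cuts paths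
  in two. The same computation with \<open>b\<close> in place of \<open>f\<close> shows that \<open>\<mu>(a)\<close> is closed.

  The entries of a defining system may be inhomogeneous, whereas the Koszul signs in the relations
  depend on degrees. The signs are therefore expressed by the additive involution \<open>x \<mapsto> (-1)\<^bsup>|x|\<^esup>x\<close>,
  applied to the entries to the left of \<open>b\<close>. In this form both sides of each relation are additive in every
  entry, so the relations extend from homogeneous to arbitrary entries
  (\<open>signed_A_infinity_relation\<close> and \<open>signed_morphism_relation\<close>).
\<close>

section \<open>Multiadditive functions of lists\<close>

text \<open>
  Additivity in each entry serves to expand sums over paths and to reduce identities to homogeneous
  entries. One function on lists of all lengths carries a whole family \<open>(f\<^sub>n)\<close>, so that the condition
  survives when some of the arguments are fixed.
\<close>

definition multiadditive :: "('a::ab_group_add list \<Rightarrow> 'b::ab_group_add) \<Rightarrow> bool" where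
  "multiadditive F \<longleftrightarrow>
    (\<forall>xs p x y. p < length xs \<longrightarrow> F (xs[p := x + y]) = F (xs[p := x]) + F (xs[p := y]))"

lemma multiadditiveI:
  assumes "\<And>xs p x y. p < length xs \<Longrightarrow> F (xs[p := x + y]) = F (xs[p := x]) + F (xs[p := y])"
  shows "multiadditive F"
  using assms by (auto simp: multiadditive_def)

lemma multiadditive_update:
  assumes "multiadditive F" "p < length xs"
  shows "F (xs[p := x + y]) = F (xs[p := x]) + F (xs[p := y])"
  using assms by (auto simp: multiadditive_def)

lemma multiadditive_slot:
  assumes "multiadditive F"
  shows "F (us @ (x + y) # vs) = F (us @ x # vs) + F (us @ y # vs)"
  using multiadditive_update[OF assms, of "length us" "us @ x # vs" x y] by simp

lemma additive_slot:
  assumes "multiadditive F"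
  shows "additive (\<lambda>x. F (us @ x # vs))"
  using multiadditive_slot[OF assms] by unfold_locales

lemma additive_single:
  assumes "multiadditive F"
  shows "additive (\<lambda>x. F [x])"
  using additive_slot[OF assms, of "[]" "[]"] by simp

lemma multiadditive_sum:
  assumes "multiadditive F"
  shows "F (us @ (\<Sum>k\<in>K. h k) # vs) = (\<Sum>k\<in>K. F (us @ h k # vs))"
  by (rule additive.sum[OF additive_slot[OF assms]])

lemma multiadditive_Cons:
  fixes F :: "'a::ab_group_add list \<Rightarrow> 'b::ab_group_add"
  assumes "multiadditive F"
  shows "multiadditive (\<lambda>xs. F (u # xs))"
proof (rule multiadditiveI)
  fix xs :: "'a list" and p x y assume "p < length xs"
  then show "F (u # xs[p := x + y]) = F (u # xs[p := x]) + F (u # xs[p := y])"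
    using multiadditive_update[OF assms, of "Suc p" "u # xs" x y] by simp
qed

lemma multiadditive_eq_0:
  assumes "multiadditive F" "p < length xs" "xs ! p = 0"
  shows "F xs = 0"
proof -
  have "xs[p := 0] = xs" using assms(3) list_update_id[of xs p] by simp
  then show ?thesis using multiadditive_update[OF assms(1,2), of 0 0] by simp
qed

lemma multiadditive_if_multilinear:
  fixes F :: "'a::ab_group_add list \<Rightarrow> 'b::ab_group_add"
  assumes "\<And>n. 1 \<le> n \<Longrightarrow> multilinear scaleA scaleB n F"
  shows "multiadditive F"
proof (rule multiadditiveI)
  fix xs :: "'a list" and p x y assume p: "p < length xs"
  then have "1 \<le> length xs" by simp
  from assms[OF this] p have "Vector_Spaces.linear scaleA scaleB (\<lambda>x. F (xs[p := x]))"
    by (auto simp: multilinear_def)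
  then show "F (xs[p := x + y]) = F (xs[p := x]) + F (xs[p := y])"
    by (rule module_hom.add[OF Vector_Spaces.linear.axioms(3)])
qed

section \<open>Cutting lists\<close>

text \<open>
  Insertions and compositions are both built from cuts of a list into an initial and a final part: an insertion
  is two successive cuts, and a composition is a first block followed by a composition of the rest.
  Formulas for them on sums over paths thus reduce to a formula for cuts.
\<close>

definition cut_sum :: "('a list \<Rightarrow> 'a list \<Rightarrow> 'b::comm_monoid_add) \<Rightarrow> 'a list \<Rightarrow> 'b" where
  "cut_sum H xs = (\<Sum>n\<le>length xs. H (take n xs) (drop n xs))"

lemma multiadditive_cut_sum:
  fixes H :: "'a::ab_group_add list \<Rightarrow> 'a list \<Rightarrow> 'b::ab_group_add"
  assumes left: "\<And>vs. multiadditive (\<lambda>us. H us vs)" and right: "\<And>us. multiadditive (H us)"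
  shows "multiadditive (cut_sum H)"
proof (rule multiadditiveI)
  fix xs :: "'a list" and p x y assume p: "p < length xs"
  have "H (take n (xs[p := x + y])) (drop n (xs[p := x + y])) =
      H (take n (xs[p := x])) (drop n (xs[p := x])) + H (take n (xs[p := y])) (drop n (xs[p := y]))"
    for n
  proof (cases "p < n")
    case True
    then show ?thesis
      using p multiadditive_update[OF left, of p "take n xs"] by (simp add: take_update_swap)
  next
    case False
    then show ?thesis
      using p multiadditive_update[OF right, of "p - n" "drop n xs"] by (simp add: drop_update_swap)
  qed
  then show "cut_sum H (xs[p := x + y]) = cut_sum H (xs[p := x]) + cut_sum H (xs[p := y])"
    by (simp add: cut_sum_def sum.distrib)
qed

text \<open>
  The right-hand side of the morphism relation, with the empty composition of 0 allowed. This makes the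
  recursion \<open>composition_sum_cut\<close> uniform: the list that remains after the last block is empty.
  The outer function \<open>G\<close> is arbitrary because the recursion absorbs the first block into it.
\<close>

definition composition_sum ::
    "('a list \<Rightarrow> 'b) \<Rightarrow> ('b list \<Rightarrow> 'c::comm_monoid_add) \<Rightarrow> 'a list \<Rightarrow> 'c" where
  "composition_sum f G xs =
    (\<Sum>is \<in> {is. (\<forall>i \<in> set is. 0 < i) \<and> sum_list is = length xs}. G (map f (blocks is xs)))"

lemma compositions_eq:
  assumes "1 \<le> n"
  shows "compositions n = {is. (\<forall>i \<in> set is. 0 < i) \<and> sum_list is = n}"
  using assms by (auto simp: compositions_def Suc_le_eq)

lemma composition_sum_Nil: "composition_sum f G [] = G []"
proof -
  have "{is. (\<forall>i \<in> set is. 0 < i) \<and> sum_list is = (0::nat)} = {[]}"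
  proof (intro set_eqI iffI)
    fix js :: "nat list"
    assume "js \<in> {is. (\<forall>i \<in> set is. 0 < i) \<and> sum_list is = 0}"
    then show "js \<in> {[]}" by (cases js) auto
  qed simp
  then show ?thesis by (simp add: composition_sum_def)
qed

text \<open>
  The first block is the initial part of the cut, and it has to be nonempty.
\<close>

lemma composition_sum_cut:
  assumes "xs \<noteq> []"
  shows "composition_sum f G xs =
    cut_sum (\<lambda>us vs. if us = [] then 0 else composition_sum f (\<lambda>ys. G (f us # ys)) vs) xs"
proof -
  define D where "D n = {is. (\<forall>i \<in> set is. 0 < i) \<and> sum_list is = (n::nat)}" for n
  define N where "N = length xs"
  have N: "1 \<le> N" using assms by (cases xs) (auto simp: N_def)
  have fin: "finite (D n)" for n
  proof (cases "1 \<le> n")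
    case True
    then show ?thesis using finite_compositions[of n] compositions_eq[OF True] by (simp add: D_def)
  next
    case False
    then have "D n \<subseteq> {[]}"
    proof (intro subsetI)
      fix js assume "js \<in> D n"
      with False show "js \<in> {[]}" by (cases js) (auto simp: D_def)
    qed
    then show ?thesis using finite_subset by blast
  qed
  have D: "D N = (\<lambda>(n, is). n # is) ` (SIGMA n:{1..N}. D (N - n))"
  proof (intro set_eqI iffI)
    fix js assume js: "js \<in> D N"
    then obtain n "is" where "js = n # is" using N by (cases js) (auto simp: D_def)
    with js show "js \<in> (\<lambda>(n, is). n # is) ` (SIGMA n:{1..N}. D (N - n))"
      by (auto simp: D_def image_iff Suc_le_eq)
  qed (auto simp: D_def)
  have inj: "inj_on (\<lambda>(n::nat, is). n # is) X" for X by (auto simp: inj_on_def)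
  have "composition_sum f G xs = (\<Sum>is\<in>D N. G (map f (blocks is xs)))"
    by (simp add: composition_sum_def D_def N_def)
  also have "\<dots> = (\<Sum>(n, is)\<in>(SIGMA n:{1..N}. D (N - n)). G (f (take n xs) # map f (blocks is (drop n xs))))"
    unfolding D sum.reindex[OF inj] by (simp add: case_prod_beta)
  also have "\<dots> = (\<Sum>n\<in>{1..N}. \<Sum>is\<in>D (N - n). G (f (take n xs) # map f (blocks is (drop n xs))))"
    by (rule sum.Sigma[symmetric]) (auto intro: fin)
  also have "\<dots> = (\<Sum>n\<in>{1..N}. composition_sum f (\<lambda>ys. G (f (take n xs) # ys)) (drop n xs))"
    by (simp add: composition_sum_def D_def N_def)
  also have "\<dots> = (\<Sum>n\<in>{1..N}. if take n xs = [] then 0 else composition_sum f (\<lambda>ys. G (f (take n xs) # ys)) (drop n xs))"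
    using assms by (intro sum.cong) auto
  also have "\<dots> = (\<Sum>n\<le>N. if take n xs = [] then 0 else composition_sum f (\<lambda>ys. G (f (take n xs) # ys)) (drop n xs))"
    by (rule sum.mono_neutral_left) (auto simp: Suc_le_eq)
  finally show ?thesis by (simp add: cut_sum_def N_def)
qed

text \<open>
  The entry \<open>p\<close> lies in exactly one block, so it is one entry of one argument of \<open>G\<close>.
\<close>

lemma composition_term_update:
  assumes "multiadditive f" "multiadditive G" "p < length xs" "sum_list is = length xs"
  shows "G (map f (blocks is (xs[p := x + y]))) =
    G (map f (blocks is (xs[p := x]))) + G (map f (blocks is (xs[p := y])))"
  using assms(2-4)
proof (induction "is" arbitrary: G xs p)
  case Nil
  then show ?case by simp
next
  case (Cons i "is")
  show ?case
  proof (cases "p < i")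
    case True
    have "f ((take i xs)[p := x + y]) = f ((take i xs)[p := x]) + f ((take i xs)[p := y])"
      using multiadditive_update[OF assms(1), of p "take i xs"] True Cons.prems(2) by simp
    with True show ?thesis
      using multiadditive_slot[OF Cons.prems(1), of "[]"] by (simp add: take_update_swap)
  next
    case False
    then show ?thesis
      using Cons.prems Cons.IH[OF multiadditive_Cons[OF Cons.prems(1)], of "p - i" "drop i xs"]
      by (simp add: drop_update_swap)
  qed
qed

lemma multiadditive_composition_sum:
  fixes f :: "'a::ab_group_add list \<Rightarrow> 'b::ab_group_add" and G :: "'b list \<Rightarrow> 'c::ab_group_add"
  assumes "multiadditive f" "multiadditive G"
  shows "multiadditive (composition_sum f G)"
proof (rule multiadditiveI)
  fix xs :: "'a list" and p x y assume p: "p < length xs"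
  then show "composition_sum f G (xs[p := x + y]) =
      composition_sum f G (xs[p := x]) + composition_sum f G (xs[p := y])"
    by (simp add: composition_sum_def composition_term_update[OF assms p] flip: sum.distrib)
qed

section \<open>The Koszul sign on inhomogeneous elements\<close>

text \<open>
  Every index is the image of an integer, and images of even integers are divisible by 2. So the
  representatives of \<open>d\<close> and \<open>e\<close> are odd.
\<close>

lemma two_dvd_plus:
  fixes d e :: "'g::grading_index"
  assumes "\<not> 2 dvd d" "\<not> 2 dvd e"
  shows "2 dvd d + e"
proof -
  obtain k where k: "d = of_int k" using of_int_surj[of d] ..
  obtain l where l: "e = of_int l" using of_int_surj[of e] ..
  have even: "2 dvd (of_int n :: 'g)" if "even n" for n
  proof -
    from that obtain p where "n = 2 * p" by (elim evenE)
    then have "(of_int n :: 'g) = 2 * of_int p" by simp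
    then show ?thesis by (rule dvdI)
  qed
  from assms even[of k] even[of l] have "even (k + l)" unfolding k l by auto
  from even[OF this] show ?thesis by (simp add: k l)
qed

lemma koszul_plus: "koszul (d + e) x = koszul d (koszul e x)"
proof (cases "2 dvd d")
  case True
  then have "2 dvd d + e \<longleftrightarrow> 2 dvd e" by (rule dvd_add_right_iff)
  with True show ?thesis by (simp add: koszul_def)
next
  case False
  show ?thesis
  proof (cases "2 dvd e")
    case True
    then have "2 dvd d + e \<longleftrightarrow> 2 dvd d" by (rule dvd_add_left_iff)
    with True show ?thesis by (simp add: koszul_def)
  next
    assume "\<not> 2 dvd e"
    with False show ?thesis using two_dvd_plus[of d e] by (simp add: koszul_def)
  qed
qed

lemma koszul_add: "koszul d (x + y) = koszul d x + koszul d y"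
  by (simp add: koszul_def)

lemma koszul_zero [simp]: "koszul d 0 = 0" "koszul 0 x = x"
  by (simp_all add: koszul_def)

lemma additive_koszul:
  assumes "additive h"
  shows "h (koszul d x) = koszul d (h x)"
  using additive.minus[OF assms] by (simp add: koszul_def)

context graded_vector_space
begin

text \<open>
  The operator \<open>sign_twist\<close> below is \<open>x \<mapsto> (-1)\<^bsup>|x|\<^esup>x\<close>, extended additively to inhomogeneous elements
  by means of their homogeneous components.
\<close>

definition is_decomposition :: "'a \<Rightarrow> ('g \<Rightarrow> 'a) \<Rightarrow> bool" where
  "is_decomposition x c \<longleftrightarrow> finite {d. c d \<noteq> 0} \<and> (\<forall>d. c d \<in> V d) \<and> x = (\<Sum>d | c d \<noteq> 0. c d)"

definition component :: "'a \<Rightarrow> 'g \<Rightarrow> 'a" where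
  "component x = (THE c. is_decomposition x c)"

definition sign_twist :: "'a \<Rightarrow> 'a" where
  "sign_twist x = (\<Sum>d | component x d \<noteq> 0. koszul d (component x d))"

lemma component: "is_decomposition x (component x)"
  unfolding component_def is_decomposition_def by (rule theI'[OF direct_sum])

lemma component_eqI:
  assumes "is_decomposition x c"
  shows "component x = c"
  using direct_sum[of x] component[of x] assms unfolding is_decomposition_def by blast

lemma component_homogeneous:
  assumes "x \<in> V d"
  shows "component x = (\<lambda>e. if e = d then x else 0)"
proof (rule component_eqI)
  have supp: "{e. (if e = d then x else 0) \<noteq> 0} = (if x = 0 then {} else {d})" by auto
  show "is_decomposition x (\<lambda>e. if e = d then x else 0)"
    unfolding is_decomposition_def supp using assms subspace_0[OF subspace_V] by auto
qed

lemma sum_support: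
  assumes "finite D" "{d. component x d \<noteq> 0} \<subseteq> D" "\<And>d. h d 0 = 0"
  shows "(\<Sum>d | component x d \<noteq> 0. h d (component x d)) = (\<Sum>d\<in>D. h d (component x d))"
  using assms by (intro sum.mono_neutral_left) auto

lemma component_add: "component (x + y) = (\<lambda>d. component x d + component y d)"
proof (rule component_eqI)
  let ?c = "\<lambda>d. component x d + component y d"
  define D where "D = {d. component x d \<noteq> 0} \<union> {d. component y d \<noteq> 0}"
  have D: "finite D" "{d. component x d \<noteq> 0} \<subseteq> D" "{d. component y d \<noteq> 0} \<subseteq> D" "{d. ?c d \<noteq> 0} \<subseteq> D"
    using component[of x] component[of y] by (auto simp: D_def is_decomposition_def)
  have "x + y = (\<Sum>d\<in>D. component x d) + (\<Sum>d\<in>D. component y d)"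
    using sum_support[OF D(1,2), of "\<lambda>d z. z"] sum_support[OF D(1,3), of "\<lambda>d z. z"]
      component[of x] component[of y] by (simp add: is_decomposition_def)
  also have "\<dots> = (\<Sum>d\<in>D. ?c d)" by (simp add: sum.distrib)
  also have "\<dots> = (\<Sum>d | ?c d \<noteq> 0. ?c d)"
    using D by (intro sum.mono_neutral_right) auto
  finally show "is_decomposition (x + y) ?c"
    using finite_subset[OF D(4,1)] subspace_add[OF subspace_V] component[of x] component[of y]
    by (auto simp: is_decomposition_def)
qed

lemma sign_twist_homogeneous:
  assumes "x \<in> V d"
  shows "sign_twist x = koszul d x"
proof -
  have "{e. (if e = d then x else 0) \<noteq> 0} = (if x = 0 then {} else {d})" by auto
  then show ?thesis by (simp add: sign_twist_def component_homogeneous[OF assms])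
qed

lemma sign_twist_add: "sign_twist (x + y) = sign_twist x + sign_twist y"
proof -
  define D where "D = {d. component x d \<noteq> 0} \<union> {d. component y d \<noteq> 0}"
  have D: "finite D" "{d. component x d \<noteq> 0} \<subseteq> D" "{d. component y d \<noteq> 0} \<subseteq> D"
      "{d. component (x + y) d \<noteq> 0} \<subseteq> D"
    using component[of x] component[of y] by (auto simp: D_def is_decomposition_def component_add)
  show ?thesis
    unfolding sign_twist_def sum_support[OF D(1,2), of koszul, simplified]
      sum_support[OF D(1,3), of koszul, simplified] sum_support[OF D(1,4), of koszul, simplified]
    by (simp add: component_add koszul_add sum.distrib)
qed

lemma homogeneous_induct [case_names homogeneous add]:
  assumes hom: "\<And>d x. x \<in> V d \<Longrightarrow> P x" and add: "\<And>x y. P x \<Longrightarrow> P y \<Longrightarrow> P (x + y)"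
  shows "P x"
proof -
  have "P (\<Sum>d\<in>D. component x d)" if "finite D" for D
    using that
  proof (induction D)
    case empty
    show ?case using hom[OF subspace_0[OF subspace_V]] by simp
  next
    case (insert d D)
    then show ?case using add hom[of "component x d" d] component[of x] by (simp add: is_decomposition_def)
  qed
  then show ?thesis using component[of x] unfolding is_decomposition_def by metis
qed

text \<open>
  The entries are freed of the homogeneity condition one at a time, from left to right: an arbitrary entry is a sum of
  homogeneous ones.
\<close>

lemma multiadditive_eqI:
  assumes F: "multiadditive F" and G: "multiadditive G"
    and eq: "\<And>xs ds. 1 \<le> length xs \<Longrightarrow> homogeneous V xs ds \<Longrightarrow> F xs = G xs"
    and xs: "xs \<noteq> []"
  shows "F xs = G xs"
proof -
  have "F (us @ vs) = G (us @ vs)" if "us @ vs \<noteq> []" "homogeneous V vs ds" for us vs ds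
    using that
  proof (induction us arbitrary: vs ds rule: rev_induct)
    case Nil
    then show ?case using eq[of vs ds] by (simp add: Suc_le_eq)
  next
    case (snoc u us)
    have "F (us @ u # vs) = G (us @ u # vs)"
    proof (induction u rule: homogeneous_induct)
      case (homogeneous d x)
      show ?case
        by (rule snoc.IH[where ds = "d # ds"]) (use homogeneous snoc.prems in \<open>auto simp: homogeneous_def\<close>)
    next
      case (add x y)
      then show ?case by (simp add: multiadditive_slot[OF F] multiadditive_slot[OF G])
    qed
    then show ?case by simp
  qed
  from this[of xs "[]" "[]"] xs show ?thesis by (simp add: homogeneous_def)
qed

text \<open>
  The operation \<open>\<Sum> g \<circ> (1\<^sup>\<otimes>\<^sup>r \<otimes> b\<^sub>s \<otimes> 1\<^sup>\<otimes>\<^sup>t)\<close> on entries that need not be homogeneous: \<open>b\<close> picks up the sign of each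
  entry that it moves past. The first cut gives \<open>r\<close> and the second \<open>s\<close>; the summand with \<open>s = 0\<close> is
  replaced by 0.
\<close>

definition signed_insertion :: "('a list \<Rightarrow> 'b::ab_group_add) \<Rightarrow> ('a list \<Rightarrow> 'a) \<Rightarrow> 'a list \<Rightarrow> 'b" where
  "signed_insertion g b = cut_sum (\<lambda>us. cut_sum (\<lambda>ys vs.
     if ys = [] then 0 else g (map sign_twist us @ b ys # vs)))"

lemma map_sign_twist_homogeneous:
  assumes "multiadditive g" "homogeneous V us ds"
  shows "g (map sign_twist us @ vs) = koszul (sum_list ds) (g (us @ vs))"
  using assms(2,1) unfolding homogeneous_def
proof (induction arbitrary: g rule: list_all2_induct)
  case Nil
  then show ?case by simp
next
  case (Cons u us d ds)
  have "g (map sign_twist (u # us) @ vs) = koszul d (g (u # map sign_twist us @ vs))"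
    using additive_koszul[OF additive_slot[OF Cons.prems, of "[]"]] Cons.hyps
    by (simp add: sign_twist_homogeneous)
  also have "\<dots> = koszul d (koszul (sum_list ds) (g (u # us @ vs)))"
    using Cons.IH[OF multiadditive_Cons[OF Cons.prems]] by simp
  finally show ?case by (simp add: koszul_plus)
qed

lemma signed_insertion_homogeneous:
  assumes "multiadditive g" "homogeneous V xs ds"
  shows "signed_insertion g b xs = insertion_sum g b xs ds"
proof -
  let ?N = "length xs"
  let ?h = "\<lambda>r s. koszul (sum_list (take r ds)) (g (take r xs @ [b (take s (drop r xs))] @ drop (r + s) xs))"
  have "signed_insertion g b xs = (\<Sum>r\<le>?N. \<Sum>s\<le>?N - r.
      if take s (drop r xs) = [] then 0 else ?h r s)"
    unfolding signed_insertion_def cut_sum_def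
  proof (rule sum.cong[OF refl], rule sum.cong)
    fix r s
    have "homogeneous V (take r xs) (take r ds)"
      using assms(2) by (simp add: homogeneous_def list_all2_takeI)
    then have "g (map sign_twist (take r xs) @ b (take s (drop r xs)) # drop s (drop r xs)) = ?h r s"
      using map_sign_twist_homogeneous[OF assms(1), of "take r xs" "take r ds"
          "b (take s (drop r xs)) # drop s (drop r xs)"] by (simp only: drop_drop append_Cons append_Nil add.commute)
    then show "(if take s (drop r xs) = [] then 0
        else g (map sign_twist (take r xs) @ b (take s (drop r xs)) # drop s (drop r xs))) =
      (if take s (drop r xs) = [] then 0 else ?h r s)"
      by (simp only:)
  qed (simp only: length_drop)
  also have "\<dots> = (\<Sum>r\<le>?N. \<Sum>s\<in>{1..?N - r}. ?h r s)"
  proof (rule sum.cong[OF refl])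
    fix r
    show "(\<Sum>s\<le>?N - r. if take s (drop r xs) = [] then 0 else ?h r s) = (\<Sum>s\<in>{1..?N - r}. ?h r s)"
      by (rule sum.mono_neutral_cong_right) (auto simp: Suc_le_eq)
  qed
  also have "\<dots> = (\<Sum>(r, s)\<in>(SIGMA r:{..?N}. {1..?N - r}). ?h r s)"
    by (rule sum.Sigma) auto
  also have "\<dots> = (\<Sum>(r, s, t) \<in> {(r, s, t). 1 \<le> s \<and> r + s + t = ?N}. ?h r s)"
    by (rule sum.reindex_bij_witness[where i = "\<lambda>(r, s, t). (r, s)" and j = "\<lambda>(r, s). (r, s, ?N - r - s)"])
      auto
  finally show ?thesis by (simp add: insertion_sum_def)
qed

lemma multiadditive_signed_insertion:
  assumes g: "multiadditive g" and b: "multiadditive b"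
  shows "multiadditive (signed_insertion g b)"
  unfolding signed_insertion_def
proof (intro multiadditive_cut_sum)
  fix vs us :: "'a list"
  show "multiadditive (\<lambda>ys. if ys = [] then 0 else g (map sign_twist us @ b ys # vs))"
    by (rule multiadditiveI) (auto simp: multiadditive_update[OF b] multiadditive_slot[OF g])
next
  fix us ys :: "'a list"
  show "multiadditive (\<lambda>vs. if ys = [] then 0 else g (map sign_twist us @ b ys # vs))"
  proof (rule multiadditiveI)
    fix vs :: "'a list" and p x y assume "p < length vs"
    then show "(if ys = [] then 0 else g (map sign_twist us @ b ys # vs[p := x + y])) =
        (if ys = [] then 0 else g (map sign_twist us @ b ys # vs[p := x])) +
        (if ys = [] then 0 else g (map sign_twist us @ b ys # vs[p := y]))"
      using multiadditive_update[OF g, of "length us + Suc p" "map sign_twist us @ b ys # vs" x y]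
      by (simp add: list_update_append)
  qed
next
  fix zs :: "'a list"
  show "multiadditive (\<lambda>us. cut_sum (\<lambda>ys vs. if ys = [] then 0 else g (map sign_twist us @ b ys # vs)) zs)"
  proof (rule multiadditiveI)
    fix us :: "'a list" and p x y assume p: "p < length us"
    have "g (map sign_twist (us[p := x + y]) @ vs) =
        g (map sign_twist (us[p := x]) @ vs) + g (map sign_twist (us[p := y]) @ vs)" for vs
      using multiadditive_update[OF g, of p "map sign_twist us @ vs" "sign_twist x" "sign_twist y"] p
      by (simp add: list_update_append map_update sign_twist_add)
    then show "cut_sum (\<lambda>ys vs. if ys = [] then 0 else g (map sign_twist (us[p := x + y]) @ b ys # vs)) zs =
        cut_sum (\<lambda>ys vs. if ys = [] then 0 else g (map sign_twist (us[p := x]) @ b ys # vs)) zs +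
        cut_sum (\<lambda>ys vs. if ys = [] then 0 else g (map sign_twist (us[p := y]) @ b ys # vs)) zs"
      unfolding cut_sum_def by (subst sum.distrib[symmetric]) (rule sum.cong, auto)
  qed
qed

end

lemma (in A_infinity_algebra) multiadditive_b: "multiadditive b"
  using multilinear_b by (rule multiadditive_if_multilinear)

lemma (in A_infinity_algebra) signed_A_infinity_relation:
  assumes "xs \<noteq> []"
  shows "signed_insertion b b xs = 0"
proof (rule multiadditive_eqI[where G = "\<lambda>_. 0"])
  show "multiadditive (signed_insertion b b)"
    by (intro multiadditive_signed_insertion multiadditive_b)
  show "multiadditive (\<lambda>_::'a list. 0::'a)" by (simp add: multiadditive_def)
  show "signed_insertion b b ys = 0" if "1 \<le> length ys" "homogeneous V ys ds" for ys ds
    using signed_insertion_homogeneous[OF multiadditive_b that(2)] A_infinity_relation[OF that] by simp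
qed fact

context A_infinity_morphism
begin

lemma multiadditive_f: "multiadditive f"
  using multilinear_f by (rule multiadditive_if_multilinear)

lemma signed_morphism_relation:
  assumes "xs \<noteq> []"
  shows "A.signed_insertion f bA xs = composition_sum f bB xs"
proof (rule A.multiadditive_eqI)
  show "multiadditive (A.signed_insertion f bA)"
    by (intro A.multiadditive_signed_insertion multiadditive_f A.multiadditive_b)
  show "multiadditive (composition_sum f bB)"
    by (intro multiadditive_composition_sum multiadditive_f B.multiadditive_b)
  show "A.signed_insertion f bA ys = composition_sum f bB ys"
    if "1 \<le> length ys" "homogeneous VA ys ds" for ys ds
    using A.signed_insertion_homogeneous[OF multiadditive_f that(2)] morphism_relation[OF that]
      compositions_eq[OF that(1)] by (simp add: composition_sum_def)
qed fact

end

section \<open>Sums over increasing paths\<close>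

text \<open>
  For a strictly upper-triangular matrix, only increasing paths contribute to the powers under \<open>\<odot>\<close>.
  The path consisting of the single vertex \<open>i = j\<close> is included: it corresponds to the empty part of a
  cut at the end of a list.
\<close>

definition paths :: "nat \<Rightarrow> nat \<Rightarrow> nat list set" where
  "paths i j = {ks. ks \<noteq> [] \<and> sorted_wrt (<) ks \<and> hd ks = i \<and> last ks = j}"

definition path_sum ::
    "(nat \<Rightarrow> nat \<Rightarrow> 'a) \<Rightarrow> ('a list \<Rightarrow> 'b::comm_monoid_add) \<Rightarrow> nat \<Rightarrow> nat \<Rightarrow> 'b" where
  "path_sum a g i j = (\<Sum>ks\<in>paths i j. g (path_tensor a ks))"

lemma paths_bounds:
  assumes "ks \<in> paths i j" "k \<in> set ks"
  shows "i \<le> k" "k \<le> j"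
proof -
  from assms(1) have ks: "ks \<noteq> []" "sorted_wrt (<) ks" "hd ks = i" "last ks = j"
    by (auto simp: paths_def)
  show "i \<le> k" using ks assms(2) by (cases ks) auto
  show "k \<le> j"
    using ks assms(2) by (cases ks rule: rev_cases) (auto simp: sorted_wrt_append)
qed

lemma finite_paths: "finite (paths i j)"
proof (rule finite_subset)
  show "paths i j \<subseteq> {ks. set ks \<subseteq> {..j} \<and> distinct ks}"
    using paths_bounds(2) by (fastforce simp: paths_def strict_sorted_iff)
qed (simp add: finite_subset_distinct)

lemma paths_same: "paths i i = {[i]}"
proof (intro set_eqI iffI)
  fix ks assume ks: "ks \<in> paths i i"
  then obtain ls where ls: "ks = i # ls" by (cases ks) (auto simp: paths_def)
  have "ls = []"
  proof (rule ccontr)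
    assume "ls \<noteq> []"
    then have "i < hd ls" using ks ls by (simp add: paths_def)
    moreover have "hd ls \<le> i" using paths_bounds(2)[OF ks] \<open>ls \<noteq> []\<close> ls by simp
    ultimately show False by simp
  qed
  with ls show "ks \<in> {[i]}" by simp
qed (simp add: paths_def)

lemma path_tensor_Cons:
  assumes "ls \<noteq> []"
  shows "path_tensor a (k # ls) = a k (hd ls) # path_tensor a ls"
  using assms by (cases ls) (auto simp: path_tensor_def)

lemma length_path_tensor: "length (path_tensor a ks) = length ks - 1"
  by (simp add: path_tensor_def)

lemma nth_path_tensor:
  assumes "Suc p < length ks"
  shows "path_tensor a ks ! p = a (ks ! p) (ks ! Suc p)"
  using assms by (simp add: path_tensor_def nth_tl)

lemma take_path_tensor: "take n (path_tensor a ks) = path_tensor a (take (Suc n) ks)"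
proof (rule nth_equalityI)
  show "length (take n (path_tensor a ks)) = length (path_tensor a (take (Suc n) ks))"
    by (auto simp: length_path_tensor)
  fix p assume "p < length (take n (path_tensor a ks))"
  then have "p < n" "Suc p < length ks" by (auto simp: length_path_tensor)
  then show "take n (path_tensor a ks) ! p = path_tensor a (take (Suc n) ks) ! p"
    by (simp add: length_path_tensor nth_path_tensor)
qed

lemma drop_path_tensor: "drop n (path_tensor a ks) = path_tensor a (drop n ks)"
proof -
  have "drop n (tl ks) = tl (drop n ks)" by (simp add: drop_Suc[symmetric] tl_drop)
  then show ?thesis by (simp only: path_tensor_def drop_map drop_zip)
qed

lemma path_tensor_nonempty:
  assumes "ks \<in> paths i j" "i < j"
  shows "path_tensor a ks \<noteq> []"
  using assms by (cases ks) (auto simp: paths_def path_tensor_Cons split: if_splits)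

lemma path_sum_same: "path_sum a g i i = g []"
  by (simp add: path_sum_def paths_same path_tensor_def)

lemma path_sum_zero [simp]: "path_sum a (\<lambda>_. 0) i j = 0"
  by (simp add: path_sum_def)

lemma path_sum_cong:
  assumes "i < j" "\<And>xs. xs \<noteq> [] \<Longrightarrow> g xs = h xs"
  shows "path_sum a g i j = path_sum a h i j"
  unfolding path_sum_def using assms by (intro sum.cong refl) (simp add: path_tensor_nonempty)

lemma path_sum_swap:
  "path_sum a (\<lambda>u. path_sum c (\<lambda>v. H u v) i' j') i j = path_sum c (\<lambda>v. path_sum a (\<lambda>u. H u v) i j) i' j'"
  unfolding path_sum_def by (rule sum.swap)

lemma path_sum_sum: "path_sum a (\<lambda>u. \<Sum>l\<in>L. h l u) i j = (\<Sum>l\<in>L. path_sum a (h l) i j)"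
  unfolding path_sum_def by (rule sum.swap)

lemma path_sum_slot:
  assumes "multiadditive G"
  shows "path_sum a (\<lambda>u. G (us @ f u # vs)) i j = G (us @ path_sum a f i j # vs)"
  unfolding path_sum_def by (rule multiadditive_sum[OF assms, symmetric])

text \<open>
  Cutting the word of a path means cutting the path at one of its vertices. As paths increase, two
  paths that meet at \<open>l\<close> can always be joined, so the two parts range over all paths independently.
\<close>

lemma path_sum_cut:
  "path_sum a (cut_sum H) i j = (\<Sum>l\<in>{i..j}. path_sum a (\<lambda>u. path_sum a (H u) l j) i l)"
proof -
  let ?S = "SIGMA ks:paths i j. {..length ks - 1}"
  let ?T = "SIGMA l:{i..j}. paths i l \<times> paths l j"
  have "path_sum a (cut_sum H) i j =
      (\<Sum>(ks, n)\<in>?S. H (path_tensor a (take (Suc n) ks)) (path_tensor a (drop n ks)))"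
    unfolding path_sum_def cut_sum_def take_path_tensor drop_path_tensor length_path_tensor
    by (rule sum.Sigma) (auto simp: finite_paths)
  also have "\<dots> = (\<Sum>(l, ks, ls)\<in>?T. H (path_tensor a ks) (path_tensor a ls))"
  proof (rule sum.reindex_bij_witness[where i = "\<lambda>(l, ks, ls). (ks @ tl ls, length ks - 1)"
        and j = "\<lambda>(ks, n). (ks ! n, take (Suc n) ks, drop n ks)"])
    fix x assume "x \<in> ?S"
    then obtain ks n where x: "x = (ks, n)" and ks: "ks \<in> paths i j" and "n \<le> length ks - 1" by auto
    then have n: "n < length ks" by (cases ks) (auto simp: paths_def)
    have tl: "tl (drop n ks) = drop (Suc n) ks" by (simp add: drop_Suc tl_drop)
    show "(case case x of (ks, n) \<Rightarrow> (ks ! n, take (Suc n) ks, drop n ks) of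
        (l, ks, ls) \<Rightarrow> (ks @ tl ls, length ks - 1)) = x"
      using n by (simp add: x tl)
    have "sorted_wrt (<) (take (Suc n) ks)" "sorted_wrt (<) (drop n ks)"
      using ks by (auto simp: paths_def sorted_wrt_take sorted_wrt_drop)
    moreover have "last (take (Suc n) ks) = ks ! n" using n by (simp add: take_Suc_conv_app_nth)
    moreover have "hd (take (Suc n) ks) = i" using ks by (cases ks) (auto simp: paths_def)
    ultimately have "take (Suc n) ks \<in> paths i (ks ! n)" "drop n ks \<in> paths (ks ! n) j"
      using ks n by (auto simp: paths_def hd_drop_conv_nth)
    then show "(case x of (ks, n) \<Rightarrow> (ks ! n, take (Suc n) ks, drop n ks)) \<in> ?T"
      using paths_bounds[OF ks, of "ks ! n"] n by (simp add: x)
    show "(case case x of (ks, n) \<Rightarrow> (ks ! n, take (Suc n) ks, drop n ks) of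
        (l, ks, ls) \<Rightarrow> H (path_tensor a ks) (path_tensor a ls)) =
      (case x of (ks, n) \<Rightarrow> H (path_tensor a (take (Suc n) ks)) (path_tensor a (drop n ks)))"
      by (simp add: x)
  next
    fix y assume "y \<in> ?T"
    then obtain l ks ls where y: "y = (l, ks, ls)"
      and ks: "ks \<in> paths i l" and ls: "ls \<in> paths l j" and l: "l \<in> {i..j}" by auto
    obtain ks' where ks': "ks = ks' @ [l]" using ks by (cases ks rule: rev_cases) (auto simp: paths_def)
    obtain ls' where ls': "ls = l # ls'" using ls by (cases ls) (auto simp: paths_def)
    show "(case case y of (l, ks, ls) \<Rightarrow> (ks @ tl ls, length ks - 1) of
        (ks, n) \<Rightarrow> (ks ! n, take (Suc n) ks, drop n ks)) = y"
      by (simp add: y ks' ls')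
    have "k < k'" if "k \<in> set ks" "k' \<in> set ls'" for k k'
      using paths_bounds(2)[OF ks that(1)] ls that(2) by (auto simp: paths_def ls')
    then have "ks @ tl ls \<in> paths i j"
      using ks ls by (auto simp: paths_def ks' ls' sorted_wrt_append hd_append)
    then show "(case y of (l, ks, ls) \<Rightarrow> (ks @ tl ls, length ks - 1)) \<in> ?S"
      by (simp add: y)
  qed
  also have "\<dots> = (\<Sum>l\<in>{i..j}. \<Sum>(ks, ls)\<in>paths i l \<times> paths l j. H (path_tensor a ks) (path_tensor a ls))"
    by (rule sum.Sigma[symmetric]) (auto simp: finite_paths)
  also have "\<dots> = (\<Sum>l\<in>{i..j}. path_sum a (\<lambda>u. path_sum a (H u) l j) i l)"
    unfolding path_sum_def sum.cartesian_product ..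
  finally show ?thesis .
qed

lemma path_sum_first_step:
  assumes "i < j"
  shows "path_sum c G i j = (\<Sum>l\<in>{i<..j}. path_sum c (\<lambda>ys. G (c i l # ys)) l j)"
proof -
  have "path_sum c G i j = (\<Sum>(l, ks)\<in>(SIGMA l:{i<..j}. paths l j). G (path_tensor c (i # ks)))"
    unfolding path_sum_def
  proof (rule sum.reindex_bij_witness[where j = "\<lambda>ks. (hd (tl ks), tl ks)" and i = "\<lambda>(l, ks). i # ks"])
    fix ks assume ks: "ks \<in> paths i j"
    then obtain ls where ls: "ks = i # ls" "ls \<noteq> []"
      using assms by (cases ks) (auto simp: paths_def split: if_splits)
    then show "(case (hd (tl ks), tl ks) of (l, ks) \<Rightarrow> i # ks) = ks" by simp
    show "(hd (tl ks), tl ks) \<in> (SIGMA l:{i<..j}. paths l j)"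
      using ks ls paths_bounds(2)[OF ks, of "hd ls"] by (auto simp: paths_def)
    show "(case (hd (tl ks), tl ks) of (l, ks) \<Rightarrow> G (path_tensor c (i # ks))) = G (path_tensor c ks)"
      using ls by simp
  next
    fix y assume "y \<in> (SIGMA l:{i<..j}. paths l j)"
    then obtain l ks where y: "y = (l, ks)" and ks: "ks \<in> paths l j" and l: "l \<in> {i<..j}" by auto
    have "i < k" if "k \<in> set ks" for k
      using paths_bounds(1)[OF ks that] l by simp
    with ks show "(case y of (l, ks) \<Rightarrow> i # ks) \<in> paths i j"
      by (auto simp: paths_def y)
    from ks show "(hd (tl (case y of (l, ks) \<Rightarrow> i # ks)), tl (case y of (l, ks) \<Rightarrow> i # ks)) = y"
      by (auto simp: paths_def y)
  qed
  also have "\<dots> = (\<Sum>l\<in>{i<..j}. \<Sum>ks\<in>paths l j. G (path_tensor c (i # ks)))"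
    by (rule sum.Sigma[symmetric]) (auto simp: finite_paths)
  also have "\<dots> = (\<Sum>l\<in>{i<..j}. path_sum c (\<lambda>ys. G (c i l # ys)) l j)"
    unfolding path_sum_def by (intro sum.cong refl) (auto simp: paths_def path_tensor_Cons)
  finally show ?thesis .
qed

section \<open>Matrices\<close>

lemma increasing_if_nonzero:
  assumes b: "multiadditive b" and a: "a \<in> Mat_plus m" and nz: "b (path_tensor a ks) \<noteq> 0"
  shows "sorted_wrt (<) ks"
proof -
  have "ks ! p < ks ! Suc p" if p: "Suc p < length ks" for p
  proof (rule ccontr)
    assume "\<not> ks ! p < ks ! Suc p"
    then have "path_tensor a ks ! p = 0"
      using a p by (simp add: nth_path_tensor Mat_plus_def)
    moreover have "p < length (path_tensor a ks)" using p by (simp add: length_path_tensor)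
    ultimately show False using multiadditive_eq_0[OF b] nz by blast
  qed
  then show ?thesis by (simp add: sorted_wrt_iff_nth_Suc_transp)
qed

text \<open>
  The summation over the length \<open>n\<close> is absorbed into the sum over paths, since an increasing path in
  \<open>{0..m}\<close> between different vertices has between 1 and \<open>m\<close> steps.
\<close>

lemma boundary_eq_path_sum:
  assumes b: "multiadditive b" and a: "a \<in> Mat_plus m" and "j \<le> m"
  shows "boundary b m a i j = (if i < j then path_sum a b i j else 0)"
proof -
  let ?I = "\<Union>n\<in>{1..m}. index_paths m n i j"
  have "boundary b m a i j = (\<Sum>ks\<in>?I. b (path_tensor a ks))"
    unfolding boundary_def apply_odot_power_def
    by (rule sum.UNION_disjoint[symmetric]) (simp_all add: finite_index_paths, auto simp: index_paths_def)
  also have "\<dots> = (\<Sum>ks\<in>(if i < j then paths i j else {}). b (path_tensor a ks))"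
  proof (rule sum.mono_neutral_right)
    show "finite ?I" by (simp add: finite_index_paths)
    show "(if i < j then paths i j else {}) \<subseteq> ?I"
    proof
      fix ks assume "ks \<in> (if i < j then paths i j else {})"
      then have ks: "ks \<in> paths i j" and "i < j" by (auto split: if_splits)
      have sub: "set ks \<subseteq> {0..m}" using paths_bounds(2)[OF ks] \<open>j \<le> m\<close> by fastforce
      have "distinct ks" using ks by (auto simp: paths_def strict_sorted_iff)
      then have "length ks \<le> m + 1"
        using card_mono[OF _ sub] by (simp add: distinct_card)
      moreover have "2 \<le> length ks"
        using path_tensor_nonempty[OF ks \<open>i < j\<close>, of a] length_path_tensor[of a ks]
        by (cases ks; cases "tl ks") (auto simp: path_tensor_def)
      moreover have "ks ! 0 = i" "ks ! (length ks - 1) = j"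
        using ks by (auto simp: paths_def hd_conv_nth last_conv_nth)
      ultimately have "ks \<in> index_paths m (length ks - 1) i j" "length ks - 1 \<in> {1..m}"
        using sub by (auto simp: index_paths_def)
      then show "ks \<in> ?I" by blast
    qed
    show "\<forall>ks\<in>?I - (if i < j then paths i j else {}). b (path_tensor a ks) = 0"
    proof (rule ballI, rule ccontr)
      fix ks assume ks: "ks \<in> ?I - (if i < j then paths i j else {})" and "b (path_tensor a ks) \<noteq> 0"
      then have sorted: "sorted_wrt (<) ks" using increasing_if_nonzero[OF b a] by blast
      from ks obtain n where n: "1 \<le> n" "length ks = n + 1" "ks ! 0 = i" "ks ! n = j"
        by (auto simp: index_paths_def)
      then have "i < j" using sorted_wrt_nth_less[OF sorted, of 0 n] by simp
      moreover have "ks \<in> paths i j"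
        using n sorted by (cases ks) (auto simp: paths_def last_conv_nth)
      ultimately show False using ks by simp
    qed
  qed
  finally show ?thesis by (simp add: path_sum_def)
qed

text \<open>
  Cutting twice separates the inserted \<open>b\<close> from the paths before and after it. Summed over the middle paths
  from \<open>k\<close> to \<open>l\<close>, it becomes \<open>path_sum a b k l\<close>, which vanishes except for the full interval; there the
  outer paths are trivial, and no sign arises.
\<close>

lemma (in graded_vector_space) path_sum_signed_insertion:
  assumes g: "multiadditive g" and "i < j"
    and zero: "\<And>k l. i \<le> k \<Longrightarrow> k < l \<Longrightarrow> l \<le> j \<Longrightarrow> (k, l) \<noteq> (i, j) \<Longrightarrow> path_sum a b k l = 0"
  shows "path_sum a (signed_insertion g b) i j = g [path_sum a b i j]"
proof -
  let ?T = "\<lambda>us ys vs. if ys = [] then 0 else g (map sign_twist us @ b ys # vs)"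
  let ?X = "path_sum a b i j"
  have middle: "path_sum a (\<lambda>ys. ?T us ys vs) k l =
      (if (k, l) = (i, j) then g (map sign_twist us @ ?X # vs) else 0)"
    if "i \<le> k" "k \<le> l" "l \<le> j" for us vs k l
  proof (cases "k < l")
    case True
    then have "path_sum a (\<lambda>ys. ?T us ys vs) k l = path_sum a (\<lambda>ys. g (map sign_twist us @ b ys # vs)) k l"
      by (rule path_sum_cong) simp
    also have "\<dots> = g (map sign_twist us @ path_sum a b k l # vs)"
      by (rule path_sum_slot[OF g])
    finally show ?thesis
      using zero[of k l] True that additive.zero[OF additive_slot[OF g]] by auto
  next
    case False
    then show ?thesis using that \<open>i < j\<close> by (auto simp: path_sum_same)
  qed
  have "path_sum a (signed_insertion g b) i j =
      (\<Sum>k\<in>{i..j}. path_sum a (\<lambda>us. \<Sum>l\<in>{k..j}. path_sum a (\<lambda>ys. path_sum a (?T us ys) l j) k l) i k)"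
    unfolding signed_insertion_def path_sum_cut ..
  also have "\<dots> = (\<Sum>k\<in>{i..j}. \<Sum>l\<in>{k..j}.
      path_sum a (\<lambda>us. path_sum a (\<lambda>vs. path_sum a (\<lambda>ys. ?T us ys vs) k l) l j) i k)"
    unfolding path_sum_sum
    by (intro sum.cong refl arg_cong[where f = "\<lambda>h. path_sum a h _ _"] ext path_sum_swap)
  also have "\<dots> = (\<Sum>k\<in>{i..j}. \<Sum>l\<in>{k..j}. if k = i then if l = j then g [?X] else 0 else 0)"
  proof (intro sum.cong refl)
    fix k l assume "k \<in> {i..j}" "l \<in> {k..j}"
    then show "path_sum a (\<lambda>us. path_sum a (\<lambda>vs. path_sum a (\<lambda>ys. ?T us ys vs) k l) l j) i k =
        (if k = i then if l = j then g [?X] else 0 else 0)"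
      by (simp add: middle path_sum_same)
  qed
  also have "\<dots> = (\<Sum>k\<in>{i..j}. if k = i then \<Sum>l\<in>{k..j}. if l = j then g [?X] else 0 else 0)"
    by (intro sum.cong) auto
  also have "\<dots> = g [?X]" using \<open>i < j\<close> by simp
  finally show ?thesis .
qed

text \<open>
  By induction on \<open>j - i\<close>: the first block of a composition cuts the path at some vertex \<open>l\<close>. Summing over the
  paths from \<open>i\<close> to \<open>l\<close> turns \<open>f\<close> of the first block into \<open>c i l\<close>, and the induction
  hypothesis, for the function that has absorbed the first argument, treats the rest.
\<close>

lemma path_sum_composition_sum:
  assumes G: "multiadditive G" and "i \<le> j"
    and c: "\<And>k l. i \<le> k \<Longrightarrow> k < l \<Longrightarrow> l \<le> j \<Longrightarrow> c k l = path_sum a f k l"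
  shows "path_sum a (composition_sum f G) i j = path_sum c G i j"
  using assms
proof (induction "j - i" arbitrary: i G rule: less_induct)
  case less
  note G = less.prems(1)
  show ?case
  proof (cases "i < j")
    case False
    then show ?thesis using less.prems(2) by (simp add: path_sum_same composition_sum_Nil)
  next
    case True
    let ?C = "\<lambda>u. composition_sum f (\<lambda>ys. G (f u # ys))"
    let ?H = "\<lambda>u v. if u = [] then 0 else ?C u v"
    have "path_sum a (composition_sum f G) i j = path_sum a (cut_sum ?H) i j"
      by (rule path_sum_cong[OF True]) (rule composition_sum_cut)
    also have "\<dots> = (\<Sum>l\<in>{i..j}. path_sum a (\<lambda>u. path_sum a (?H u) l j) i l)"
      by (rule path_sum_cut)
    \<comment> \<open>For \<open>l = i\<close> the first block is empty.\<close>
    also have "\<dots> = (\<Sum>l\<in>{i<..j}. path_sum a (\<lambda>u. path_sum a (?H u) l j) i l)"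
      by (rule sum.mono_neutral_right) (auto simp: path_sum_same)
    also have "\<dots> = (\<Sum>l\<in>{i<..j}. path_sum c (\<lambda>ys. G (c i l # ys)) l j)"
    proof (rule sum.cong[OF refl])
      fix l assume l: "l \<in> {i<..j}"
      have "path_sum a (\<lambda>u. path_sum a (?H u) l j) i l = path_sum a (\<lambda>u. path_sum a (?C u) l j) i l"
        by (rule path_sum_cong) (use l in auto)
      also have "\<dots> = path_sum a (\<lambda>u. path_sum c (\<lambda>ys. G (f u # ys)) l j) i l"
        using l less.prems(3)
        by (intro arg_cong[where f = "\<lambda>h. path_sum a h _ _"] ext less.hyps multiadditive_Cons[OF G]) auto
      also have "\<dots> = path_sum c (\<lambda>ys. path_sum a (\<lambda>u. G ([] @ f u # ys)) i l) l j"
        unfolding append_Nil by (rule path_sum_swap)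
      also have "\<dots> = path_sum c (\<lambda>ys. G (c i l # ys)) l j"
        unfolding path_sum_slot[OF G] using l less.prems(3)[of i l] by simp
      finally show "path_sum a (\<lambda>u. path_sum a (?H u) l j) i l = path_sum c (\<lambda>ys. G (c i l # ys)) l j" .
    qed
    also have "\<dots> = path_sum c G i j" by (rule path_sum_first_step[OF True, symmetric])
    finally show ?thesis .
  qed
qed

section \<open>Naturality of Massey products\<close>

lemma defining_system_boundary:
  assumes "defining_system b m \<alpha> a" "i \<le> m" "j \<le> m" "(i, j) \<noteq> (0, m)"
  shows "boundary b m a i j = 0"
  using assms by (auto simp: defining_system_def approx_eq_def)

lemma defining_system_path_sum:
  assumes "multiadditive b" "defining_system b m \<alpha> a" "i < j" "j \<le> m" "(i, j) \<noteq> (0, m)"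
  shows "path_sum a b i j = 0"
  using defining_system_boundary[OF assms(2), of i j] assms
  by (simp add: boundary_eq_path_sum defining_system_def)

lemma massey_value_eq_path_sum:
  assumes "multiadditive b" "a \<in> Mat_plus m" "1 \<le> m"
  shows "massey_value b m a = path_sum a b 0 m"
  using assms by (simp add: massey_value_def boundary_eq_path_sum)

lemma path_sum_Suc: "path_sum a g i (Suc i) = g [a i (Suc i)]"
proof -
  have "{i<..Suc i} = {Suc i}" by auto
  then show ?thesis by (simp add: path_sum_first_step path_sum_same)
qed

text \<open>
  For \<open>m \<ge> 2\<close> the entry \<open>(i, i + 1)\<close> is not the exempt entry \<open>(0, m)\<close>.
\<close>

lemma defining_system_closed:
  assumes "multiadditive b" "defining_system b m \<alpha> a" "2 \<le> m" "i < m"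
  shows "b [a i (Suc i)] = 0"
proof -
  have "(i, Suc i) \<noteq> (0, m)" using assms(3) by auto
  then show ?thesis
    using defining_system_path_sum[OF assms(1,2), of i "Suc i"] assms(4) by (simp add: path_sum_Suc)
qed

text \<open>
  Summing the \<open>A\<^sub>\<infinity>\<close>-relation over all paths from \<open>0\<close> to \<open>m\<close> leaves only the term \<open>b\<^sub>1(\<mu>(a))\<close>.
\<close>

lemma (in A_infinity_algebra) massey_value_closed:
  assumes a: "defining_system b m \<alpha> a" and "1 \<le> m"
  shows "b [massey_value b m a] = 0"
proof -
  have M: "a \<in> Mat_plus m" using a by (simp add: defining_system_def)
  have "b [path_sum a b 0 m] = path_sum a (signed_insertion b b) 0 m"
    using \<open>1 \<le> m\<close> defining_system_path_sum[OF multiadditive_b a]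
    by (intro path_sum_signed_insertion[symmetric] multiadditive_b) auto
  also have "\<dots> = path_sum a (\<lambda>_. 0) 0 m"
    using \<open>1 \<le> m\<close> by (intro path_sum_cong) (auto simp: signed_A_infinity_relation)
  finally show ?thesis using massey_value_eq_path_sum[OF multiadditive_b M \<open>1 \<le> m\<close>] by simp
qed

context A_infinity_morphism
begin

definition push_matrix :: "nat \<Rightarrow> (nat \<Rightarrow> nat \<Rightarrow> 'a) \<Rightarrow> nat \<Rightarrow> nat \<Rightarrow> 'b" where
  "push_matrix m a i j = (if i < j \<and> j \<le> m then path_sum a f i j else 0)"

lemma push_matrix_Mat_plus: "push_matrix m a \<in> Mat_plus m"
  by (auto simp: push_matrix_def Mat_plus_def)

text \<open>
  The identity \<open>\<partial>\<^sub>c c = f\<^sub>1(\<partial>\<^sub>a a)\<close> at the entry \<open>(i, j)\<close>. The entries of \<open>\<partial>\<^sub>a a\<close> strictly inside the interval have to vanish,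
  for otherwise they would contribute terms \<open>f(\<dots>, (\<partial>\<^sub>a a)\<^sub>k\<^sub>l, \<dots>)\<close>.
\<close>

lemma path_sum_push_matrix:
  assumes "i < j" "j \<le> m"
    and zero: "\<And>k l. i \<le> k \<Longrightarrow> k < l \<Longrightarrow> l \<le> j \<Longrightarrow> (k, l) \<noteq> (i, j) \<Longrightarrow> path_sum a bA k l = 0"
  shows "path_sum (push_matrix m a) bB i j = f [path_sum a bA i j]"
proof -
  have "path_sum (push_matrix m a) bB i j = path_sum a (composition_sum f bB) i j"
    using assms by (intro path_sum_composition_sum[symmetric] B.multiadditive_b) (auto simp: push_matrix_def)
  also have "\<dots> = path_sum a (A.signed_insertion f bA) i j"
    using \<open>i < j\<close> by (intro path_sum_cong) (auto simp: signed_morphism_relation)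
  also have "\<dots> = f [path_sum a bA i j]"
    by (rule A.path_sum_signed_insertion[OF multiadditive_f \<open>i < j\<close> zero])
  finally show ?thesis .
qed

lemma cochain_map: "f [bA [y]] = bB [f [y]]"
proof -
  \<comment> \<open>Between two adjacent vertices there is a single path, with one step, so that
    the identity for sums over paths from 0 to 1 is the claim.\<close>
  define a where "a i j = y" for i j :: nat
  have "path_sum (push_matrix 1 a) bB 0 1 = f [path_sum a bA 0 1]"
    by (rule path_sum_push_matrix) auto
  then show ?thesis
    using path_sum_Suc[of "push_matrix 1 a" bB 0] path_sum_Suc[of a bA 0] path_sum_Suc[of a f 0]
    by (simp add: push_matrix_def a_def)
qed

lemma coh_map_f:
  assumes "bA [x] = 0"
  shows "coh_map (\<lambda>y. bB [y]) (\<lambda>x. f [x]) (coh_class (\<lambda>x. bA [x]) x) = coh_class (\<lambda>y. bB [y]) (f [x])"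
  using assms cochain_map A.multiadditive_b B.multiadditive_b multiadditive_f
  by (intro coh_map_coh_class additive_single) auto

lemma defining_system_push_matrix:
  assumes a: "defining_system bA m \<alpha> a" and m: "2 \<le> m"
  shows "defining_system bB m (\<lambda>i. coh_map (\<lambda>y. bB [y]) (\<lambda>x. f [x]) (\<alpha> i)) (push_matrix m a)"
    and "massey_value bB m (push_matrix m a) = f [massey_value bA m a]"
proof -
  note zero = defining_system_path_sum[OF A.multiadditive_b a]
  have M: "a \<in> Mat_plus m" using a by (simp add: defining_system_def)
  have push: "path_sum (push_matrix m a) bB i j = f [path_sum a bA i j]" if "i < j" "j \<le> m" for i j
    using that by (intro path_sum_push_matrix zero) auto
  show "massey_value bB m (push_matrix m a) = f [massey_value bA m a]"
    using m push[of 0 m] massey_value_eq_path_sum[OF B.multiadditive_b push_matrix_Mat_plus, of m a]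
      massey_value_eq_path_sum[OF A.multiadditive_b M] by simp
  have "approx_eq m (boundary bB m (push_matrix m a)) (\<lambda>i j. 0)"
    unfolding approx_eq_def
    using push zero additive.zero[OF additive_single[OF multiadditive_f]]
    by (auto simp: boundary_eq_path_sum[OF B.multiadditive_b push_matrix_Mat_plus])
  moreover have "coh_map (\<lambda>y. bB [y]) (\<lambda>x. f [x]) (\<alpha> i) =
      coh_class (\<lambda>x. bB [x]) (push_matrix m a (i - 1) i)" if i: "i \<in> {1..m}" for i
  proof -
    obtain k where k: "i = Suc k" "k < m" using i by (cases i) auto
    have "\<alpha> i = coh_class (\<lambda>x. bA [x]) (a k (Suc k))"
      using a i k by (auto simp: defining_system_def)
    then show ?thesis
      using coh_map_f[OF defining_system_closed[OF A.multiadditive_b a m k(2)]] k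
      by (simp add: push_matrix_def path_sum_Suc)
  qed
  ultimately show "defining_system bB m (\<lambda>i. coh_map (\<lambda>y. bB [y]) (\<lambda>x. f [x]) (\<alpha> i)) (push_matrix m a)"
    by (simp add: defining_system_def push_matrix_Mat_plus)
qed

lemma massey_product_natural:
  assumes m: "2 \<le> m"
  shows "coh_map (\<lambda>y. bB [y]) (\<lambda>x. f [x]) ` massey_product bA m \<alpha>
    \<subseteq> massey_product bB m (\<lambda>i. coh_map (\<lambda>y. bB [y]) (\<lambda>x. f [x]) (\<alpha> i))"
proof
  fix \<beta> assume "\<beta> \<in> coh_map (\<lambda>y. bB [y]) (\<lambda>x. f [x]) ` massey_product bA m \<alpha>"
  then obtain a where a: "defining_system bA m \<alpha> a"
    and \<beta>: "\<beta> = coh_map (\<lambda>y. bB [y]) (\<lambda>x. f [x]) (coh_class (\<lambda>x. bA [x]) (massey_value bA m a))"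
    by (auto simp: massey_product_def)
  have "\<beta> = coh_class (\<lambda>y. bB [y]) (f [massey_value bA m a])"
    unfolding \<beta> using m by (intro coh_map_f A.massey_value_closed[OF a]) simp
  with defining_system_push_matrix[OF a m]
  show "\<beta> \<in> massey_product bB m (\<lambda>i. coh_map (\<lambda>y. bB [y]) (\<lambda>x. f [x]) (\<alpha> i))"
    unfolding massey_product_def by (metis (mono_tags, lifting) mem_Collect_eq)
qed

end

theorem corollary4p16:
  fixes scaleA :: "'k::field \<Rightarrow> 'a::ab_group_add \<Rightarrow> 'a"
    and VA :: "'g::grading_index \<Rightarrow> 'a set"
    and bA :: "'a list \<Rightarrow> 'a"
    and scaleB :: "'k \<Rightarrow> 'b::ab_group_add \<Rightarrow> 'b"
    and VB :: "'g \<Rightarrow> 'b set"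
    and bB :: "'b list \<Rightarrow> 'b"
    and f :: "'a list \<Rightarrow> 'b"
    and m :: nat
    and \<alpha> :: "nat \<Rightarrow> 'a set"
  defines "f_star \<equiv> coh_map (\<lambda>y. bB [y]) (\<lambda>x. f [x])"
  assumes "A_infinity_morphism scaleA VA bA scaleB VB bB f"
    and "m \<ge> 2"
    and "\<And>i. i \<in> {1..m} \<Longrightarrow> \<alpha> i \<in> cohomology (\<lambda>x. bA [x])"
    and "massey_defined bA m \<alpha>"
  shows "massey_defined bB m (\<lambda>i. f_star (\<alpha> i)) \<and>
    f_star ` massey_product bA m \<alpha> \<subseteq> massey_product bB m (\<lambda>i. f_star (\<alpha> i))"
proof -
  interpret A_infinity_morphism scaleA VA bA scaleB VB bB f by fact
  from assms(5) obtain a where "defining_system bA m \<alpha> a" by (auto simp: massey_defined_def)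
  from defining_system_push_matrix(1)[OF this \<open>m \<ge> 2\<close>] massey_product_natural[OF \<open>m \<ge> 2\<close>]
  show ?thesis unfolding massey_defined_def f_star_def by blast
qed

end
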